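(* Let $k\ge2$ and $n\ge1$ be integers, let $p\in(0,1]$, and let $T=(t_{\mathbf i})_{\mathbf i\in[n]^k}$ have independent $\mathrm{Bernoulli}(p)$ entries. Fix an integer $L\ge 1$ and $R>0$, and put $K=2(R+k+3)$. With probability at least $1-n^{-R}$, simultaneously for every choice of a labeled partial partition (with labels in $\{0,\dots,L-1\}$) in every mode $j=1,\dots,k$ and every nonempty collection $\mathcal B$ of its box labels, $$\sum_{\mathbf b\in\mathcal B}I_{\mathbf b}\le K\bigl(H(\mathcal B)+|\mathcal B|\log(eL)\bigr).$$
   Context: Write $[n]=\{1,\dots,n\}$; $\log$ is the natural logarithm and, inside logarithms, $e$ is Euler's number. Rate function: for $\mu>0$ and $u\ge 0$, $I_\mu(u)=u\log(u/\mu)-u+\mu$ if $u\ge\mu$, and $I_\mu(u)=0$ if $0\le u<\mu$. Box counts: a box is a set $Q=S_1\times\cdots\times S_k$ with $S_j\subseteq[n]$, and $e(Q)=\sum_{\mathbf i\in Q}t_{\mathbf i}$. Labeled partial partitions: in mode $j\in\{1,\dots,k\}$, a labeled partial partition consists of pairwise disjoint nonempty sets $D_j^\ell\subseteq[n]$, for $\ell$ ranging over some subset of labels of $\{0,\dots,L-1\}$ (the assigned labels in mode $j$). Classes in different modes are unrelated (no disjointness is required between modes). Given one labeled partial partition in each mode, a box label is a tuple $\mathbf b=(\ell_1,\dots,\ell_k)$ with $\ell_j$ an assigned label in mode $j$; write $\mathbf b_j=\ell_j$, and define $$Q_{\mathbf b}=D_1^{\ell_1}\times\cdots\times D_k^{\ell_k},\qquad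 \mu_{\mathbf b}=p|Q_{\mathbf b}|,\qquad I_{\mathbf b}=I_{\mu_{\mathbf b}}(e(Q_{\mathbf b})).$$ Entropy: for a collection $\mathcal B$ of box labels let $\mathcal B_j=\{\mathbf b_j:\mathbf b\in\mathcal B\}$ and, for nonempty $S\subseteq[n]$, $h(S)=|S|\log\frac{en}{|S|}$. Then $$H(\mathcal B)=\sum_{j=1}^k\sum_{\ell\in\mathcal B_j}h(D_j^\ell).$$ *)

theory Defs
  imports "HOL-Probability.Probability"
begin

text \<open>Multi-indices, box labels and boxes are (extensional) functions on the set of modes
  \<open>{1..k}\<close>; an array is a function on multi-indices.\<close>

definition index_set :: "nat \<Rightarrow> nat \<Rightarrow> (nat \<Rightarrow> nat) set" where
  "index_set k n = {1..k} \<rightarrow>\<^sub>E {1..n}"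

definition rate :: "real \<Rightarrow> real \<Rightarrow> real" where
  "rate \<mu> u = (if \<mu> \<le> u then u * ln (u / \<mu>) - u + \<mu> else 0)"

definition box_count :: "((nat \<Rightarrow> nat) \<Rightarrow> real) \<Rightarrow> (nat \<Rightarrow> nat) set \<Rightarrow> real" where
  "box_count T Q = (\<Sum>i\<in>Q. T i)"

text \<open>A labeled partial partition of one mode is given by its set \<open>A\<close> of assigned labels and its
  classes \<open>D l\<close>; the values of \<open>D\<close> outside \<open>A\<close> are irrelevant.\<close>

definition labeled_partial_partition ::
    "nat \<Rightarrow> nat \<Rightarrow> nat set \<Rightarrow> (nat \<Rightarrow> nat set) \<Rightarrow> bool" where
  "labeled_partial_partition n L A D \<longleftrightarrow>
     A \<subseteq> {0..<L} \<and> (\<forall>l\<in>A. D l \<noteq> {} \<and> D l \<subseteq> {1..n}) \<and> disjoint_family_on D A"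

text \<open>From here on \<open>A j\<close> and \<open>D j\<close> are the assigned labels and the classes of mode \<open>j\<close>.\<close>

definition box_labels :: "nat \<Rightarrow> (nat \<Rightarrow> nat set) \<Rightarrow> (nat \<Rightarrow> nat) set" where
  "box_labels k A = (\<Pi>\<^sub>E j\<in>{1..k}. A j)"

definition label_box ::
    "nat \<Rightarrow> (nat \<Rightarrow> nat \<Rightarrow> nat set) \<Rightarrow> (nat \<Rightarrow> nat) \<Rightarrow> (nat \<Rightarrow> nat) set" where
  "label_box k D b = (\<Pi>\<^sub>E j\<in>{1..k}. D j (b j))"

definition label_rate ::
    "nat \<Rightarrow> real \<Rightarrow> ((nat \<Rightarrow> nat) \<Rightarrow> real) \<Rightarrow> (nat \<Rightarrow> nat \<Rightarrow> nat set) \<Rightarrow> (nat \<Rightarrow> nat) \<Rightarrow> real" where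
  "label_rate k p T D b =
     rate (p * real (card (label_box k D b))) (box_count T (label_box k D b))"

definition set_entropy :: "nat \<Rightarrow> nat set \<Rightarrow> real" where
  "set_entropy n S = real (card S) * ln (exp 1 * real n / real (card S))"

definition entropy_sum ::
    "nat \<Rightarrow> nat \<Rightarrow> (nat \<Rightarrow> nat \<Rightarrow> nat set) \<Rightarrow> (nat \<Rightarrow> nat) set \<Rightarrow> real" where
  "entropy_sum k n D B = (\<Sum>j\<in>{1..k}. \<Sum>l\<in>(\<lambda>b. b j) ` B. set_entropy n (D j l))"

end

theory Submission
  imports Defs
begin

text \<open>Chernoff's bound gives \<open>P(I\<^sub>b \<ge> s) \<le> e\<^sup>-\<^sup>s\<close> for every box, hence
  \<open>E exp(I\<^sub>b / 2) \<le> 6\<close>. The boxes of a collection \<open>B\<close> are disjoint, so the \<open>I\<^sub>b\<close> are independent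
  and Markov's inequality gives \<open>P(\<Sum> I\<^sub>b > 2 a) \<le> 6\<^bsup>|B|\<^esup> e\<^bsup>-a\<^esup>\<close>. Take
  \<open>a = c (H(B) + |B| ln (e L))\<close> with \<open>c = R + k + 3\<close> and sum over all \<open>B\<close> and all classes
  carrying a label of \<open>B\<close>. As there are at most \<open>exp(h(S))\<close> sets of the size of \<open>S\<close>, the sum over
  one class is at most \<open>n\<^bsup>-R\<^esup>\<close>; the sum over \<open>B\<close> is at most
  \<open>(1 + 6 (e L)\<^bsup>-c\<^esup>)\<^bsup>N\<^esup> - 1 \<le> 1\<close> with \<open>N = L\<^bsup>k\<^esup>\<close>.\<close>

section \<open>Calculus of the rate function\<close>

lemma rate_nonneg:
  assumes "0 < \<mu>"
  shows "0 \<le> rate \<mu> u"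
proof (cases "\<mu> \<le> u")
  case True
  then have "0 < u" using assms by linarith
  have "ln (\<mu> / u) \<le> \<mu> / u - 1"
    using assms \<open>0 < u\<close> by (intro ln_le_minus_one) simp
  then have "u * ln (\<mu> / u) \<le> u * (\<mu> / u - 1)"
    using \<open>0 < u\<close> by (intro mult_left_mono) auto
  also have "\<dots> = \<mu> - u"
    using \<open>0 < u\<close> by (simp add: field_simps)
  finally have "u * ln (\<mu> / u) \<le> \<mu> - u" .
  moreover have "ln (\<mu> / u) = - ln (u / \<mu>)"
    using assms \<open>0 < u\<close> by (simp add: ln_div)
  ultimately show ?thesis
    using True by (simp add: rate_def)
qed (simp add: rate_def)

text \<open>No derivative is taken: \<open>ln (u / x) \<ge> 1 - x / u\<close> bounds the increment
  below by \<open>(u - x) * (ln (u / \<mu>) + x / u - 1)\<close>. The second factor is positive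
  because \<open>ln (\<mu> / u) < \<mu> / u - 1 \<le> x / u - 1\<close>, strict since
  \<open>\<mu> / u\<close> is not 1.\<close>

lemma rate_strict_mono:
  assumes "0 < \<mu>" "\<mu> \<le> x" "x < u"
  shows "rate \<mu> x < rate \<mu> u"
proof -
  have pos: "0 < x" "0 < u" using assms by auto
  have "ln (x / u) \<le> x / u - 1"
    using pos by (intro ln_le_minus_one) simp
  then have A: "x * (1 - x / u) \<le> x * ln (u / x)"
    using pos by (intro mult_left_mono) (auto simp: ln_div)
  have "0 < \<mu> / u" "\<mu> / u \<noteq> 1"
    using assms by auto
  then have "ln (\<mu> / u) < \<mu> / u - 1"
    using ln_le_minus_one[of "\<mu> / u"] ln_eq_minus_one[of "\<mu> / u"] by linarith
  moreover have "\<mu> / u \<le> x / u"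
    using assms pos by (simp add: divide_right_mono)
  ultimately have "0 < ln (u / \<mu>) + x / u - 1"
    using assms pos by (simp add: ln_div)
  then have "0 < (u - x) * (ln (u / \<mu>) + x / u - 1)"
    using assms by (intro mult_pos_pos) auto
  also have "\<dots> = (u - x) * ln (u / \<mu>) + x * (1 - x / u) - (u - x)"
    using pos by (simp add: field_simps)
  also have "\<dots> \<le> (u - x) * ln (u / \<mu>) + x * ln (u / x) - (u - x)"
    using A by simp
  also have "\<dots> = rate \<mu> u - rate \<mu> x"
    using assms pos by (simp add: rate_def ln_div algebra_simps)
  finally show ?thesis by simp
qed

text \<open>Intermediate value theorem. It turns a level \<open>s\<close> of the rate into a
  threshold \<open>u\<close> for the random variable itself.\<close>

lemma rate_attains:
  assumes "0 < \<mu>" "0 < s"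
  obtains u where "\<mu> < u" "rate \<mu> u = s"
proof -
  define f where "f u = u * ln (u / \<mu>) - u + \<mu>" for u :: real
  \<comment> \<open>\<open>U \<ge> \<mu> * exp 2\<close> makes the logarithm at least 2, so
    \<open>f U \<ge> U + \<mu>\<close>, and \<open>U \<ge> s\<close> then gives
    \<open>f U \<ge> s\<close>.\<close>
  define U where "U = max (\<mu> * exp 2) s"
  have "\<mu> \<le> U" using assms by (auto simp: U_def le_max_iff_disj)
  have "0 < U" using assms by (auto simp: U_def)
  have "2 = ln (\<mu> * exp 2 / \<mu>)" using assms by simp
  also have "\<dots> \<le> ln (U / \<mu>)"
    using assms \<open>0 < U\<close> by (intro ln_mono divide_right_mono) (auto simp: U_def)
  finally have "U * 2 \<le> U * ln (U / \<mu>)"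
    using \<open>0 < U\<close> by (intro mult_left_mono) auto
  moreover have "s \<le> U" by (simp add: U_def)
  ultimately have "s \<le> f U" using assms unfolding f_def by linarith
  moreover have "f \<mu> \<le> s" using assms by (simp add: f_def)
  moreover have "continuous_on {\<mu>..U} f"
    unfolding f_def using assms by (intro continuous_intros) auto
  ultimately obtain u where u: "\<mu> \<le> u" "f u = s"
    using IVT'[of f \<mu> s U] \<open>\<mu> \<le> U\<close> by auto
  moreover have "u \<noteq> \<mu>" using u assms by (auto simp: f_def)
  ultimately show ?thesis using that[of u] by (auto simp: rate_def f_def)
qed

lemma rate_measurable [measurable]: "rate \<mu> \<in> borel_measurable borel"
  unfolding rate_def[abs_def] by measurable

section \<open>Tail and exponential moment bounds for box counts\<close>

context prob_space
begin

text \<open>Chernoff's bound at the optimal exponent. The hypothesis \<open>mgf\<close> compares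
  with a Poisson variable of mean \<open>\<mu>\<close>, whose large deviation rate above the mean is
  \<open>rate \<mu>\<close>. For \<open>l = ln (u / \<mu>)\<close> the exponent
  \<open>- l * u + \<mu> * (exp l - 1)\<close> is exactly \<open>- rate \<mu> u\<close>.\<close>

lemma rate_tail:
  assumes [measurable]: "random_variable borel X"
    and "0 < \<mu>"
    and mgf: "\<And>l. 0 < l \<Longrightarrow> (\<integral>\<^sup>+\<omega>. ennreal (exp (l * X \<omega>)) \<partial>M) \<le> ennreal (exp (\<mu> * (exp l - 1)))"
    and "0 \<le> s"
  shows "emeasure M {\<omega> \<in> space M. s \<le> rate \<mu> (X \<omega>)} \<le> ennreal (exp (- s))"
proof (cases "s = 0")
  case True
  then show ?thesis by (simp add: emeasure_le_1)
next
  case False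
  then obtain u where u: "\<mu> < u" "rate \<mu> u = s"
    using rate_attains[OF \<open>0 < \<mu>\<close>, of s] \<open>0 \<le> s\<close> by auto
  define l where "l = ln (u / \<mu>)"
  have "0 < l" using u \<open>0 < \<mu>\<close> by (simp add: l_def)
  \<comment> \<open>Between \<open>\<mu>\<close> and \<open>u\<close> this is strict monotonicity;
    under \<open>\<mu>\<close> the rate has its default value 0, which is below \<open>s\<close>
    because the level 0 was treated separately.\<close>
  have "\<not> rate \<mu> x \<ge> s" if "x < u" for x
  proof (cases "\<mu> \<le> x")
    case True
    then show ?thesis using rate_strict_mono[of \<mu> x u] that u \<open>0 < \<mu>\<close> by simp
  next
    case F: False
    then show ?thesis using False \<open>0 \<le> s\<close> by (simp add: rate_def)
  qed
  then have "{\<omega> \<in> space M. s \<le> rate \<mu> (X \<omega>)} \<subseteq> {\<omega> \<in> space M. u \<le> X \<omega>}"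
    by (auto simp: not_less[symmetric])
  then have "emeasure M {\<omega> \<in> space M. s \<le> rate \<mu> (X \<omega>)} \<le> emeasure M {\<omega> \<in> space M. u \<le> X \<omega>}"
    by (intro emeasure_mono) auto
  also have "\<dots> \<le> ennreal (exp (- l * u)) *
      (\<integral>\<^sup>+\<omega>. ennreal (exp (l * X \<omega>)) * indicator (space M) \<omega> \<partial>M)"
    using \<open>0 < l\<close> by (intro Chernoff_ineq_nn_integral_ge) auto
  also have "(\<integral>\<^sup>+\<omega>. ennreal (exp (l * X \<omega>)) * indicator (space M) \<omega> \<partial>M)
      = (\<integral>\<^sup>+\<omega>. ennreal (exp (l * X \<omega>)) \<partial>M)"
    by (intro nn_integral_cong) auto
  also have "ennreal (exp (- l * u)) * \<dots> \<le> ennreal (exp (- l * u)) * ennreal (exp (\<mu> * (exp l - 1)))"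
    using mgf[OF \<open>0 < l\<close>] by (intro mult_left_mono) auto
  also have "\<dots> = ennreal (exp (- l * u + \<mu> * (exp l - 1)))"
    unfolding exp_add by (simp add: ennreal_mult')
  also have "- l * u + \<mu> * (exp l - 1) = - s"
    using u \<open>0 < \<mu>\<close> by (simp add: l_def rate_def[of \<mu> u] flip: \<open>rate \<mu> u = s\<close>) (simp add: algebra_simps)
  finally show ?thesis .
qed

text \<open>The factor 1/2 makes the bounding series geometric with ratio
  \<open>exp (- 1 / 2)\<close>; with the full rate its terms would not decay.\<close>

lemma rate_exp_moment:
  assumes [measurable]: "random_variable borel X"
    and "0 < \<mu>"
    and tail: "\<And>s. 0 \<le> s \<Longrightarrow>
      emeasure M {\<omega> \<in> space M. s \<le> rate \<mu> (X \<omega>)} \<le> ennreal (exp (- s))"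
  shows "(\<integral>\<^sup>+\<omega>. ennreal (exp (rate \<mu> (X \<omega>) / 2)) \<partial>M) \<le> 6"
proof -
  define S where "S m = {\<omega> \<in> space M. real m \<le> rate \<mu> (X \<omega>)}" for m
  define c where "c m = exp ((real m + 1) / 2)" for m :: nat
  define a where "a = exp (1 / 2 :: real)"
  have S [measurable]: "S m \<in> sets M" for m unfolding S_def by measurable
  \<comment> \<open>The series below sums to \<open>a * a / (a - 1)\<close>, so these two bounds
    yield the constant 6.\<close>
  have a: "3 / 2 \<le> a" "a * a \<le> 3"
    using exp_ge_add_one_self[of "1/2"] exp_le by (auto simp: a_def simp flip: exp_add)
  have pow: "exp (- (real m) / 2) = (1 / a) ^ m" for m
    by (simp add: a_def exp_minus field_simps flip: exp_of_nat_mult)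
  \<comment> \<open>Split at the integer part \<open>m\<close> of the rate: \<open>S m\<close> has probability at most \<open>e\<^bsup>-m\<^esup>\<close>.\<close>
  have "(\<integral>\<^sup>+\<omega>. ennreal (exp (rate \<mu> (X \<omega>) / 2)) \<partial>M)
      \<le> (\<integral>\<^sup>+\<omega>. (\<Sum>m. ennreal (c m) * indicator (S m) \<omega>) \<partial>M)"
  proof (rule nn_integral_mono)
    fix \<omega> assume "\<omega> \<in> space M"
    define m where "m = nat \<lfloor>rate \<mu> (X \<omega>)\<rfloor>"
    have "0 \<le> rate \<mu> (X \<omega>)" by (rule rate_nonneg) fact
    then have m: "real m \<le> rate \<mu> (X \<omega>)" "rate \<mu> (X \<omega>) \<le> real m + 1"
      unfolding m_def by linarith+
    define f where "f i = ennreal (c i) * indicator (S i) \<omega>" for i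
    have "ennreal (exp (rate \<mu> (X \<omega>) / 2)) \<le> f m"
      using m \<open>\<omega> \<in> space M\<close> by (simp add: f_def c_def S_def ennreal_leI)
    also have "\<dots> \<le> (\<Sum>i. f i)"
      using sum_le_suminf[of f "{m}"] by simp
    finally show "ennreal (exp (rate \<mu> (X \<omega>) / 2)) \<le> (\<Sum>i. ennreal (c i) * indicator (S i) \<omega>)"
      unfolding f_def .
  qed
  also have "\<dots> = (\<Sum>m. ennreal (c m) * emeasure M (S m))"
    by (subst nn_integral_suminf) (auto simp: nn_integral_cmult_indicator)
  also have "\<dots> \<le> (\<Sum>m. ennreal (a * (1 / a) ^ m))"
  proof (intro suminf_le allI)
    fix m
    have "ennreal (c m) * emeasure M (S m) \<le> ennreal (c m) * ennreal (exp (- real m))"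
      using tail[of "real m"] by (intro mult_left_mono) (auto simp: S_def)
    also have "\<dots> = ennreal (a * (1 / a) ^ m)"
      by (simp add: ennreal_mult'[symmetric] c_def pow[symmetric])
        (simp add: a_def field_simps flip: exp_add)
    finally show "ennreal (c m) * emeasure M (S m) \<le> \<dots>" .
  qed auto
  also have "\<dots> = ennreal (a * (1 / (1 - 1 / a)))"
  proof (intro suminf_ennreal_eq)
    show "(\<lambda>m. a * (1 / a) ^ m) sums (a * (1 / (1 - 1 / a)))"
      using a by (intro sums_mult geometric_sums) auto
  qed (use a in auto)
  also have "a * (1 / (1 - 1 / a)) \<le> 6"
  proof -
    have "a * (1 / (1 - 1 / a)) = a * a / (a - 1)" using a by (simp add: field_simps)
    also have "\<dots> \<le> 3 / (1 / 2)" using a by (intro frac_le) auto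
    finally show ?thesis by simp
  qed
  then have "ennreal (a * (1 / (1 - 1 / a))) \<le> ennreal 6" by (rule ennreal_leI)
  finally show ?thesis by simp
qed

text \<open>Markov's inequality is applied to the exponential of half the sum, so a threshold
  \<open>2 * a\<close> is paid for by \<open>exp (- a)\<close>. This is the origin of the factor 2
  in \<open>K\<close>.\<close>

lemma rate_sum_tail:
  assumes "finite B"
    and ind: "indep_vars (\<lambda>_. borel) X B"
    and moment: "\<And>b. b \<in> B \<Longrightarrow> (\<integral>\<^sup>+\<omega>. ennreal (exp (rate (\<mu> b) (X b \<omega>) / 2)) \<partial>M) \<le> 6"
  shows "prob {\<omega> \<in> space M. (\<Sum>b\<in>B. rate (\<mu> b) (X b \<omega>)) > 2 * a} \<le> 6 ^ card B * exp (- a)"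
proof -
  have X [measurable]: "b \<in> B \<Longrightarrow> random_variable borel (X b)" for b
    using ind by (auto simp: indep_vars_def)
  have [measurable]: "(\<lambda>\<omega>. \<Sum>b\<in>B. rate (\<mu> b) (X b \<omega>)) \<in> borel_measurable M"
    by (intro borel_measurable_sum) auto
  have "indep_vars (\<lambda>_. borel) (\<lambda>b \<omega>. ennreal (exp (rate (\<mu> b) (X b \<omega>) / 2))) B"
    by (rule indep_vars_compose2[OF ind]) measurable
  then have prod: "(\<integral>\<^sup>+\<omega>. (\<Prod>b\<in>B. ennreal (exp (rate (\<mu> b) (X b \<omega>) / 2))) \<partial>M)
      = (\<Prod>b\<in>B. \<integral>\<^sup>+\<omega>. ennreal (exp (rate (\<mu> b) (X b \<omega>) / 2)) \<partial>M)"
    using \<open>finite B\<close> by (intro indep_vars_nn_integral) auto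
  have "emeasure M {\<omega> \<in> space M. (\<Sum>b\<in>B. rate (\<mu> b) (X b \<omega>)) > 2 * a}
      \<le> emeasure M {\<omega> \<in> space M. (\<Sum>b\<in>B. rate (\<mu> b) (X b \<omega>)) \<ge> 2 * a}"
    by (intro emeasure_mono) auto
  also have "\<dots> \<le> ennreal (exp (- (1 / 2) * (2 * a))) * (\<integral>\<^sup>+\<omega>. ennreal
      (exp ((1 / 2) * (\<Sum>b\<in>B. rate (\<mu> b) (X b \<omega>)))) * indicator (space M) \<omega> \<partial>M)"
    by (intro Chernoff_ineq_nn_integral_ge) auto
  also have "(\<integral>\<^sup>+\<omega>. ennreal (exp ((1 / 2) * (\<Sum>b\<in>B. rate (\<mu> b) (X b \<omega>)))) * indicator (space M) \<omega> \<partial>M)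
      = (\<integral>\<^sup>+\<omega>. (\<Prod>b\<in>B. ennreal (exp (rate (\<mu> b) (X b \<omega>) / 2))) \<partial>M)"
    using \<open>finite B\<close> by (intro nn_integral_cong) (simp add: prod_ennreal exp_sum sum_divide_distrib)
  also have "ennreal (exp (- (1 / 2) * (2 * a))) * \<dots> \<le> ennreal (exp (- a)) * (\<Prod>b\<in>B. 6)"
    unfolding prod by (intro mult_mono prod_mono_ennreal moment) auto
  also have "\<dots> = ennreal (6 ^ card B * exp (- a))"
    by (simp add: ennreal_mult' ennreal_power mult.commute)
      (metis ennreal_numeral ennreal_power zero_le_numeral)
  finally show ?thesis
    by (simp add: emeasure_eq_measure)
qed

text \<open>Each Bernoulli factor \<open>1 + p * (exp l - 1)\<close> is at most the Poisson factor
  \<open>exp (p * (exp l - 1))\<close>. This supplies the hypothesis \<open>mgf\<close> of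
  \<open>rate_tail\<close> with mean \<open>p * real (card Q)\<close>.\<close>

lemma bernoulli_sum_mgf:
  assumes "finite Q" "indep_vars (\<lambda>_. borel) t Q" "0 \<le> p" "p \<le> 1"
    and dist: "\<And>i. i \<in> Q \<Longrightarrow>
      distr M borel (t i) = distr (measure_pmf (bernoulli_pmf p)) borel of_bool"
  shows "(\<integral>\<^sup>+\<omega>. ennreal (exp (l * (\<Sum>i\<in>Q. t i \<omega>))) \<partial>M)
    \<le> ennreal (exp (p * real (card Q) * (exp l - 1)))"
proof -
  have t: "random_variable borel (t i)" if "i \<in> Q" for i
    using assms that by (auto simp: indep_vars_def)
  have one: "(\<integral>\<^sup>+\<omega>. ennreal (exp (l * t i \<omega>)) \<partial>M) \<le> ennreal (exp (p * (exp l - 1)))" if "i \<in> Q" for i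
  proof -
    have "(\<integral>\<^sup>+\<omega>. ennreal (exp (l * t i \<omega>)) \<partial>M) = (\<integral>\<^sup>+x. ennreal (exp (l * x)) \<partial>distr M borel (t i))"
      using t[OF that] by (simp add: nn_integral_distr)
    also have "\<dots> = (\<integral>\<^sup>+x. ennreal (exp (l * of_bool x)) \<partial>measure_pmf (bernoulli_pmf p))"
      unfolding dist[OF that] by (simp add: nn_integral_distr)
    also have "\<dots> = ennreal (1 + p * (exp l - 1))"
      using assms by (simp add: ennreal_mult'[symmetric] flip: ennreal_1 ennreal_plus)
        (simp add: algebra_simps)
    also have "\<dots> \<le> ennreal (exp (p * (exp l - 1)))"
      by (intro ennreal_leI exp_ge_add_one_self)
    finally show ?thesis .
  qed
  have "indep_vars (\<lambda>_. borel) (\<lambda>i \<omega>. ennreal (exp (l * t i \<omega>))) Q"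
    by (rule indep_vars_compose2[OF assms(2)]) measurable
  then have prod: "(\<integral>\<^sup>+\<omega>. (\<Prod>i\<in>Q. ennreal (exp (l * t i \<omega>))) \<partial>M)
      = (\<Prod>i\<in>Q. \<integral>\<^sup>+\<omega>. ennreal (exp (l * t i \<omega>)) \<partial>M)"
    using \<open>finite Q\<close> by (intro indep_vars_nn_integral) auto
  have "(\<integral>\<^sup>+\<omega>. ennreal (exp (l * (\<Sum>i\<in>Q. t i \<omega>))) \<partial>M) = (\<integral>\<^sup>+\<omega>. (\<Prod>i\<in>Q. ennreal (exp (l * t i \<omega>))) \<partial>M)"
    using \<open>finite Q\<close> by (intro nn_integral_cong) (simp add: prod_ennreal exp_sum sum_distrib_left)
  also have "\<dots> \<le> (\<Prod>i\<in>Q. ennreal (exp (p * (exp l - 1))))"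
    unfolding prod by (intro prod_mono_ennreal one)
  also have "\<dots> = ennreal (exp (p * real (card Q) * (exp l - 1)))"
    by (simp add: ennreal_power mult_ac flip: exp_of_nat_mult)
  finally show ?thesis .
qed

text \<open>The tuples of variables over disjoint blocks are independent, and each sum is a
  measurable function of its tuple.\<close>

lemma indep_vars_block_sums:
  assumes "indep_vars (\<lambda>_. borel) t I"
    and "\<And>b. b \<in> B \<Longrightarrow> Q b \<subseteq> I" "disjoint_family_on Q B"
  shows "indep_vars (\<lambda>_. borel) (\<lambda>b \<omega>. \<Sum>i\<in>Q b. t i \<omega> :: real) B"
proof -
  have "indep_vars (\<lambda>b. PiM (Q b) (\<lambda>_. borel)) (\<lambda>b \<omega>. restrict (\<lambda>i. t i \<omega>) (Q b)) B"
    using assms by (intro indep_vars_restrict)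
  then have "indep_vars (\<lambda>_. borel) (\<lambda>b \<omega>. \<Sum>i\<in>Q b. restrict (\<lambda>i. t i \<omega>) (Q b) i) B"
    by (rule indep_vars_compose2) measurable
  then show ?thesis by simp
qed

lemma bernoulli_block_rate_tail:
  assumes ind: "indep_vars (\<lambda>_. borel) t I" and "0 < p" "p \<le> 1"
    and dist: "\<And>i. i \<in> I \<Longrightarrow>
      distr M borel (t i) = distr (measure_pmf (bernoulli_pmf p)) borel of_bool"
    and "finite I" "finite B"
    and Q: "\<And>b. b \<in> B \<Longrightarrow> Q b \<subseteq> I" "\<And>b. b \<in> B \<Longrightarrow> Q b \<noteq> {}" "disjoint_family_on Q B"
  shows "prob {\<omega> \<in> space M. (\<Sum>b\<in>B. rate (p * real (card (Q b))) (\<Sum>i\<in>Q b. t i \<omega>)) > 2 * a}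
    \<le> 6 ^ card B * exp (- a)"
proof (rule rate_sum_tail)
  show sums: "indep_vars (\<lambda>_. borel) (\<lambda>b \<omega>. \<Sum>i\<in>Q b. t i \<omega>) B"
    using ind Q by (intro indep_vars_block_sums)
  fix b assume b: "b \<in> B"
  have fin: "finite (Q b)" using Q(1)[OF b] \<open>finite I\<close> by (rule finite_subset)
  have rv: "random_variable borel (\<lambda>\<omega>. \<Sum>i\<in>Q b. t i \<omega>)"
    using sums b by (auto simp: indep_vars_def)
  \<comment> \<open>A nonempty block has a positive mean, as the lemmas on \<open>rate\<close>
    require.\<close>
  have pos: "0 < p * real (card (Q b))"
    using fin Q(2)[OF b] \<open>0 < p\<close> by (simp add: card_gt_0_iff)
  have "(\<integral>\<^sup>+\<omega>. ennreal (exp (l * (\<Sum>i\<in>Q b. t i \<omega>))) \<partial>M)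
      \<le> ennreal (exp (p * real (card (Q b)) * (exp l - 1)))" for l
    using fin Q(1)[OF b] assms by (intro bernoulli_sum_mgf indep_vars_subset[OF ind] dist) auto
  then show "(\<integral>\<^sup>+\<omega>. ennreal (exp (rate (p * real (card (Q b))) (\<Sum>i\<in>Q b. t i \<omega>) / 2)) \<partial>M) \<le> 6"
    using rv pos by (intro rate_exp_moment rate_tail)
qed fact

end


section \<open>Entropy as a counting bound, and the sums of the union bound\<close>

lemma binomial_le_exp_entropy:
  assumes "1 \<le> d" "d \<le> n"
  shows "real (n choose d) \<le> exp (real d * ln (exp 1 * real n / real d))"
proof -
  \<comment> \<open>Keep one term of the binomial expansion of \<open>(1 + d / n)\<^bsup>n\<^esup> \<le> e\<^bsup>d\<^esup>\<close>.\<close>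
  define x where "x = real d / real n"
  have "0 < x" using assms by (simp add: x_def)
  have "real (n choose d) * x ^ d = real (n choose d) * x ^ d * 1 ^ (n - d)" by simp
  also have "\<dots> \<le> (\<Sum>i\<le>n. real (n choose i) * x ^ i * 1 ^ (n - i))"
    using assms \<open>0 < x\<close> by (intro member_le_sum) auto
  also have "\<dots> = (x + 1) ^ n" by (rule binomial_ring[symmetric])
  also have "\<dots> \<le> exp x ^ n"
    using exp_ge_add_one_self[of x] \<open>0 < x\<close> by (intro power_mono) (auto simp: add.commute)
  also have "\<dots> = exp (real d)"
    using assms by (simp add: x_def flip: exp_of_nat_mult)
  finally have "real (n choose d) \<le> exp (real d) / x ^ d"
    using \<open>0 < x\<close> by (simp add: field_simps)
  also have "\<dots> = (exp 1 * real n / real d) ^ d"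
    by (simp add: x_def power_divide power_mult_distrib flip: exp_of_nat_mult)
  also have "\<dots> = exp (real d * ln (exp 1 * real n / real d))"
    using assms by (simp add: exp_of_nat_mult)
  finally show ?thesis .
qed

text \<open>The left side is the entropy of a singleton, the smallest possible. The difference of
  the two sides is \<open>(d - 1) * (ln n - ln d) + (d - 1 - ln d)\<close>, and both terms are
  nonnegative.\<close>

lemma entropy_ge:
  assumes "1 \<le> d" "d \<le> n"
  shows "1 + ln (real n) \<le> real d * ln (exp 1 * real n / real d)"
proof -
  have "(real d - 1) * ln (real d) \<le> (real d - 1) * ln (real n)"
    using assms by (intro mult_left_mono ln_mono) auto
  moreover have "ln (real d) \<le> real d - 1"
    using assms by (intro ln_le_minus_one) auto
  ultimately show ?thesis
    using assms by (simp add: ln_div ln_mult algebra_simps)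
qed

text \<open>Group the sets by size. Counting the sets of one size uses up one unit of
  \<open>c\<close>, and the rest is bounded through the entropy of a singleton.\<close>

lemma sum_exp_neg_set_entropy_le:
  assumes "1 \<le> n" "0 \<le> R" "R + 2 \<le> c"
  shows "(\<Sum>S\<in>Pow {1..n} - {{}}. exp (- c * set_entropy n S)) \<le> real n powr (- R)"
proof -
  define h where "h d = real d * ln (exp 1 * real n / real d)" for d
  define P where "P = Pow {1..n} - {{}}"
  have card_P: "card ` P \<subseteq> {1..n}"
    using card_mono[of "{1..n}"] by (fastforce simp: P_def Suc_le_eq card_gt_0_iff finite_subset)
  have "finite P" by (simp add: P_def)
  have "(\<Sum>S\<in>P. exp (- c * set_entropy n S))
      = (\<Sum>d\<in>{1..n}. \<Sum>S | S \<in> P \<and> card S = d. exp (- c * set_entropy n S))"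
    using card_P \<open>finite P\<close> by (intro sum.group[symmetric]) auto
  also have "\<dots> \<le> (\<Sum>d\<in>{1..n}. exp (- (c - 1) * (1 + ln (real n))))"
  proof (rule sum_mono)
    fix d assume d: "d \<in> {1..n}"
    have P_d: "{S. S \<in> P \<and> card S = d} = {S. S \<subseteq> {1..n} \<and> card S = d}"
      using d by (auto simp: P_def)
    have "(\<Sum>S | S \<subseteq> {1..n} \<and> card S = d. exp (- c * set_entropy n S))
        = (\<Sum>S | S \<subseteq> {1..n} \<and> card S = d. exp (- c * h d))"
      by (intro sum.cong) (auto simp: set_entropy_def h_def)
    also have "\<dots> = real (n choose d) * exp (- c * h d)"
      by (simp add: n_subsets)
    also have "\<dots> \<le> exp (h d) * exp (- c * h d)"
      using binomial_le_exp_entropy[of d n] d by (intro mult_right_mono) (auto simp: h_def)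
    also have "\<dots> = exp (- (c - 1) * h d)"
      by (simp add: algebra_simps flip: exp_add)
    also have "\<dots> \<le> exp (- (c - 1) * (1 + ln (real n)))"
      using entropy_ge[of d n] d assms by (auto simp: h_def intro!: mult_left_mono)
    finally show "(\<Sum>S | S \<in> P \<and> card S = d. exp (- c * set_entropy n S))
        \<le> exp (- (c - 1) * (1 + ln (real n)))"
      using P_d by simp
  qed
  \<comment> \<open>The first summand comes from the \<open>n\<close> possible sizes. As
    \<open>c - 1 \<ge> R + 1\<close>, it is absorbed and \<open>- R * ln (real n)\<close>
    remains.\<close>
  also have "\<dots> = exp (ln (real n) + - (c - 1) * (1 + ln (real n)))"
    unfolding exp_add using assms by simp
  also have "\<dots> \<le> exp (- R * ln (real n))"
  proof -
    have "(R + 1) * (1 + ln (real n)) \<le> (c - 1) * (1 + ln (real n))"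
      using assms by (intro mult_right_mono) auto
    moreover have "(R + 1) * (1 + ln (real n)) = R + 1 + R * ln (real n) + ln (real n)"
      "- (c - 1) * (1 + ln (real n)) = - ((c - 1) * (1 + ln (real n)))"
      by (simp_all add: algebra_simps)
    ultimately have "ln (real n) + - (c - 1) * (1 + ln (real n)) \<le> - R * ln (real n)"
      using assms by linarith
    then show ?thesis by (subst exp_le_cancel_iff)
  qed
  also have "\<dots> = real n powr (- R)"
    using assms by (simp add: powr_def)
  finally show ?thesis by (simp add: P_def)
qed

lemma sum_power_card_Pow:
  assumes "finite X"
  shows "(\<Sum>B\<in>Pow X - {{}}. x ^ card B) = (1 + x :: real) ^ card X - 1"
proof -
  have "(\<Sum>B\<in>Pow X. x ^ card B) = (\<Prod>i\<in>X. x + 1)"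
    using assms by (subst prod_add) auto
  then show ?thesis
    using assms by (subst sum_diff) (auto simp: add.commute)
qed

text \<open>With \<open>x\<close> the weight of one label, the sum equals
  \<open>(1 + x) ^ card X - 1\<close>, at most \<open>exp (real L ^ k * x) - 1\<close>. The exponent
  is at most 1/2, since \<open>c \<ge> k + 3\<close> beats the \<open>L ^ k\<close> labels.\<close>

lemma sum_label_weight_le:
  assumes "1 \<le> L" "2 \<le> k" "real k + 3 \<le> c"
    and X: "finite X" "card X = L ^ k"
  shows "(\<Sum>B\<in>Pow X - {{}}. (6 * exp (- c * ln (exp 1 * real L))) ^ card B) \<le> 1"
proof -
  define x where "x = 6 * exp (- c * ln (exp 1 * real L))"
  have L: "0 \<le> ln (real L)" "exp (ln (real L)) = real L" using assms by auto
  have "real L ^ k * x = 6 * exp (real k * ln (real L) - c * (1 + ln (real L)))"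
    using assms L by (simp add: x_def ln_mult exp_diff exp_minus exp_of_nat_mult distrib_left exp_add field_simps)
  \<comment> \<open>After \<open>k * ln L\<close> cancels, at least \<open>k + 3\<close> remains to
    be subtracted, and \<open>k \<ge> 2\<close> makes this at least 5.\<close>
  also have "real k * ln (real L) - c * (1 + ln (real L)) \<le> - 5"
  proof -
    have "(real k + 3) * (1 + ln (real L)) \<le> c * (1 + ln (real L))"
      using assms L by (intro mult_right_mono) auto
    then have "real k + 3 + real k * ln (real L) + 3 * ln (real L) \<le> c * (1 + ln (real L))"
      by (simp add: algebra_simps)
    then show ?thesis using assms L by linarith
  qed
  also have "6 * exp (- 5 :: real) \<le> 1 / 2"
  proof -
    have "(2 :: real) ^ 5 \<le> exp 1 ^ 5"
      using exp_ge_add_one_self[of 1] by (intro power_mono) auto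
    also have "\<dots> = exp (5 :: real)" by (simp flip: exp_of_nat_mult)
    finally show ?thesis by (simp add: exp_minus field_simps)
  qed
  finally have Lx: "real L ^ k * x \<le> 1 / 2" by simp
  have "(1 + x) ^ card X \<le> exp x ^ card X"
    by (intro power_mono exp_ge_add_one_self) (simp add: x_def)
  also have "\<dots> = exp (real L ^ k * x)"
    by (simp add: X flip: exp_of_nat_mult)
  also have "\<dots> \<le> exp (1 / 2)" using Lx by simp
  also have "\<dots> \<le> (2 :: real)"
  proof (rule power2_le_imp_le)
    show "(exp (1 / 2) :: real)\<^sup>2 \<le> 2\<^sup>2"
      using exp_le by (simp add: power2_eq_square flip: exp_add)
  qed simp
  finally show ?thesis
    using sum_power_card_Pow[OF X(1), of x] by (simp add: x_def)
qed

text \<open>\<open>J\<close> consists of the pairs of a mode and a label used by \<open>B\<close>.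
  The classes range independently over nonempty sets, so the sum factorizes into
  \<open>card J\<close> equal factors.\<close>

lemma sum_exp_neg_entropy_sum_le:
  fixes k n :: nat and B :: "(nat \<Rightarrow> nat) set"
  defines "J \<equiv> SIGMA j:{1..k}. (\<lambda>b. b j) ` B"
  assumes "1 \<le> n" "0 \<le> R" "R + 2 \<le> c" "1 \<le> k" "finite B" "B \<noteq> {}"
  shows "(\<Sum>D\<in>J \<rightarrow>\<^sub>E (Pow {1..n} - {{}}). exp (- c * entropy_sum k n (curry D) B)) \<le> real n powr (- R)"
proof -
  define q where "q = (\<Sum>S\<in>Pow {1..n} - {{}}. exp (- c * set_entropy n S))"
  have "finite J" using assms by (simp add: J_def)
  have "J \<noteq> {}" using assms by (auto simp: J_def Sigma_empty_iff)
  have q: "0 \<le> q" "q \<le> real n powr (- R)"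
    using sum_exp_neg_set_entropy_le[of n R c] assms by (auto simp: q_def sum_nonneg)
  have "real n powr (- R) \<le> 1"
    using assms by (simp add: powr_minus ge_one_powr_ge_zero inverse_le_1_iff)
  have "entropy_sum k n (curry D) B = (\<Sum>x\<in>J. set_entropy n (D x))" for D
    using assms by (simp add: entropy_sum_def J_def sum.Sigma case_prod_unfold)
  then have "(\<Sum>D\<in>J \<rightarrow>\<^sub>E (Pow {1..n} - {{}}). exp (- c * entropy_sum k n (curry D) B))
      = (\<Sum>D\<in>J \<rightarrow>\<^sub>E (Pow {1..n} - {{}}). \<Prod>x\<in>J. exp (- c * set_entropy n (D x)))"
    using \<open>finite J\<close> by (simp add: sum_distrib_left flip: exp_sum)
  also have "\<dots> = q ^ card J"
    using \<open>finite J\<close> by (subst prod_sum_PiE[symmetric]) (auto simp: q_def)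
  \<comment> \<open>As \<open>q \<le> 1\<close> and \<open>J\<close> is nonempty, one factor already
    gives the bound.\<close>
  also have "\<dots> \<le> q ^ 1"
    using q \<open>real n powr (- R) \<le> 1\<close> \<open>finite J\<close> \<open>J \<noteq> {}\<close>
    by (intro power_decreasing) (auto simp: Suc_le_eq card_gt_0_iff)
  finally show ?thesis using q by simp
qed

section \<open>Boxes of a collection and their dependence on the classes\<close>

lemma label_box_properties:
  assumes part: "\<And>j. j \<in> {1..k} \<Longrightarrow> labeled_partial_partition n L (A j) (D j)"
    and B: "B \<subseteq> box_labels k A"
  shows "b \<in> B \<Longrightarrow> label_box k D b \<subseteq> index_set k n"
    and "b \<in> B \<Longrightarrow> label_box k D b \<noteq> {}"
    and "disjoint_family_on (label_box k D) B"
proof -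
  have mem: "b j \<in> A j" if "b \<in> B" "j \<in> {1..k}" for b j
    using B that by (auto simp: box_labels_def PiE_iff subset_iff)
  show "label_box k D b \<subseteq> index_set k n" if "b \<in> B"
    using mem[OF that] part unfolding label_box_def index_set_def
    by (intro PiE_mono) (auto simp: labeled_partial_partition_def)
  show "label_box k D b \<noteq> {}" if "b \<in> B"
    using mem[OF that] part
    by (auto simp: label_box_def PiE_eq_empty_iff labeled_partial_partition_def)
  show "disjoint_family_on (label_box k D) B"
    unfolding disjoint_family_on_def
  proof (intro ballI impI)
    fix b b' assume b: "b \<in> B" "b' \<in> B" "b \<noteq> b'"
    \<comment> \<open>Labels are extensional, so distinct ones differ in a mode within
      \<open>{1..k}\<close>, and there the two classes are disjoint.\<close>
    then obtain j where j: "j \<in> {1..k}" "b j \<noteq> b' j"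
      using B PiE_ext[of b "{1..k}" A b'] by (auto simp: box_labels_def)
    then have "D j (b j) \<inter> D j (b' j) = {}"
      using part[OF j(1)] mem b unfolding labeled_partial_partition_def disjoint_family_on_def
      by blast
    then show "label_box k D b \<inter> label_box k D b' = {}"
      using j(1) unfolding label_box_def by (blast dest: PiE_mem)
  qed
qed

lemma label_rate_cong:
  assumes "\<And>j. j \<in> {1..k} \<Longrightarrow> D j (b j) = D' j (b j)"
  shows "label_rate k p T D b = label_rate k p T D' b"
proof -
  have "label_box k D b = label_box k D' b"
    unfolding label_box_def using assms by (intro PiE_cong)
  then show ?thesis by (simp add: label_rate_def)
qed

lemma entropy_sum_cong:
  assumes "\<And>j b. j \<in> {1..k} \<Longrightarrow> b \<in> B \<Longrightarrow> D j (b j) = D' j (b j)"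
  shows "entropy_sum k n D B = entropy_sum k n D' B"
  unfolding entropy_sum_def using assms by (intro sum.cong refl) auto

section \<open>Union bound over collections and classes\<close>

theorem lemma4p5:
  fixes M :: "'a measure"
    and t :: "(nat \<Rightarrow> nat) \<Rightarrow> 'a \<Rightarrow> real"
    and k n L :: nat and p R K :: real
  assumes "prob_space M"
    and "k \<ge> 2" and "n \<ge> 1"
    and "0 < p" and "p \<le> 1"
    and "prob_space.indep_vars M (\<lambda>_. borel) t (index_set k n)"
    and "\<And>i. i \<in> index_set k n \<Longrightarrow>
           distr M borel (t i) = distr (measure_pmf (bernoulli_pmf p)) borel of_bool"
    and "L \<ge> 1" and "R > 0"
    and "K = 2 * (R + real k + 3)"
  shows "measure M {\<omega> \<in> space M.
           \<forall>A D B. (\<forall>j\<in>{1..k}. labeled_partial_partition n L (A j) (D j)) \<and>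
                   B \<subseteq> box_labels k A \<and> B \<noteq> {} \<longrightarrow>
             (\<Sum>b\<in>B. label_rate k p (\<lambda>i. t i \<omega>) D b)
               \<le> K * (entropy_sum k n D B + real (card B) * ln (exp 1 * real L))}
         \<ge> 1 - real n powr (- R)"
proof -
  interpret prob_space M by fact
  define c where "c = R + real k + 3"
  have K: "K = 2 * c" using assms by (simp add: c_def)
  define X where "X = {1..k} \<rightarrow>\<^sub>E {0..<L}"
  have X: "finite X" "card X = L ^ k"
    by (simp_all add: X_def finite_PiE card_PiE)
  \<comment> \<open>Both sides of the inequality see only the classes at these pairs. Storing them
    as an extensional function on \<open>J B\<close>, with the labels used by \<open>B\<close> as
    the assigned ones, leaves a finite index set \<open>F\<close>.\<close>
  define J :: "(nat \<Rightarrow> nat) set \<Rightarrow> (nat \<times> nat) set"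
    where "J B = (SIGMA j:{1..k}. (\<lambda>b. b j) ` B)" for B
  define E where "E B = J B \<rightarrow>\<^sub>E (Pow {1..n} - {{}})" for B
  define V where "V B = {D \<in> E B. \<forall>j\<in>{1..k}.
      labeled_partial_partition n L ((\<lambda>b. b j) ` B) (curry D j)}" for B
  define F where "F = Sigma (Pow X - {{}}) V"
  define good where "good \<omega> D B \<longleftrightarrow> (\<Sum>b\<in>B. label_rate k p (\<lambda>i. t i \<omega>) D b)
      \<le> K * (entropy_sum k n D B + real (card B) * ln (exp 1 * real L))" for \<omega> D B
  define bad where "bad = (\<lambda>(B, D). {\<omega> \<in> space M. \<not> good \<omega> (curry D) B})"
  have finB: "finite B" if "B \<subseteq> X" for B using that X finite_subset by blast
  have finE: "finite (E B)" if "B \<subseteq> X" for B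
    unfolding E_def J_def using finB[OF that] by (intro finite_PiE finite_SigmaI) auto
  then have finF: "finite F"
    unfolding F_def V_def using X by (intro finite_SigmaI) auto
  have t: "random_variable borel (t i)" if "i \<in> index_set k n" for i
    using assms(6) that by (auto simp: indep_vars_def)

  \<comment> \<open>The bound is written as a weight per label times an entropy weight, so that the
    sums over \<open>B\<close> and over \<open>D\<close> can be treated separately.\<close>
  have bad_meas: "bad (B, D) \<in> sets M" and
    bad_prob: "prob (bad (B, D)) \<le> (6 * exp (- c * ln (exp 1 * real L))) ^ card B
      * exp (- c * entropy_sum k n (curry D) B)" if "(B, D) \<in> F" for B D
  proof -
    have B: "B \<subseteq> X" and D: "D \<in> V B" using that by (auto simp: F_def)
    have sub: "B \<subseteq> box_labels k (\<lambda>j. (\<lambda>b. b j) ` B)"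
      using B by (auto simp: X_def box_labels_def PiE_iff subset_iff)
    have part: "\<And>j. j \<in> {1..k} \<Longrightarrow> labeled_partial_partition n L ((\<lambda>b. b j) ` B) (curry D j)"
      using D by (auto simp: V_def)
    note box = label_box_properties[of k n L, OF part sub]
    have [measurable]: "(\<lambda>\<omega>. \<Sum>b\<in>B. label_rate k p (\<lambda>i. t i \<omega>) (curry D) b) \<in> borel_measurable M"
      unfolding label_rate_def box_count_def
      using box(1) t by (intro borel_measurable_sum measurable_compose[OF _ rate_measurable]) auto
    show "bad (B, D) \<in> sets M"
      by (simp add: bad_def good_def not_le)
    define W where "W = entropy_sum k n (curry D) B + real (card B) * ln (exp 1 * real L)"
    have "prob (bad (B, D)) \<le> 6 ^ card B * exp (- (c * W))"
    proof -
      have "finite (index_set k n)" by (simp add: index_set_def finite_PiE)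
      then have "prob {\<omega> \<in> space M. (\<Sum>b\<in>B. rate (p * real (card (label_box k (curry D) b)))
          (\<Sum>i\<in>label_box k (curry D) b. t i \<omega>)) > 2 * (c * W)} \<le> 6 ^ card B * exp (- (c * W))"
        using assms finB[OF B] box by (intro bernoulli_block_rate_tail[where I = "index_set k n"])
      then show ?thesis
        by (simp add: bad_def good_def not_le label_rate_def box_count_def K W_def mult.assoc)
    qed
    also have "\<dots> = (6 * exp (- c * ln (exp 1 * real L))) ^ card B
        * exp (- c * entropy_sum k n (curry D) B)"
      by (simp add: W_def algebra_simps exp_add power_mult_distrib flip: exp_of_nat_mult)
        (simp add: exp_minus exp_add field_simps exp_diff)
    finally show "prob (bad (B, D)) \<le> \<dots>" .
  qed

  \<comment> \<open>This writes the event as the complement of a finite union; it is also why it is measurable.\<close>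
  have "{\<omega> \<in> space M. \<forall>A D B. (\<forall>j\<in>{1..k}. labeled_partial_partition n L (A j) (D j)) \<and>
      B \<subseteq> box_labels k A \<and> B \<noteq> {} \<longrightarrow> good \<omega> D B} = space M - (\<Union>x\<in>F. bad x)" (is "?G = _")
  proof (intro equalityI subsetI)
    fix \<omega> assume \<omega>: "\<omega> \<in> ?G"
    have good: "good \<omega> D B" if "\<forall>j\<in>{1..k}. labeled_partial_partition n L (A j) (D j)"
      "B \<subseteq> box_labels k A" "B \<noteq> {}" for A D B
      using \<omega> that by blast
    have "good \<omega> (curry D) B" if "(B, D) \<in> F" for B D
    proof (rule good)
      show "B \<subseteq> box_labels k (\<lambda>j. (\<lambda>b. b j) ` B)"
        using that by (auto simp: F_def X_def box_labels_def PiE_iff subset_iff)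
    qed (use that in \<open>auto simp: F_def V_def\<close>)
    then show "\<omega> \<in> space M - (\<Union>x\<in>F. bad x)" using \<omega> by (auto simp: bad_def)
  next
    fix \<omega> assume \<omega>: "\<omega> \<in> space M - (\<Union>x\<in>F. bad x)"
    have "good \<omega> D B" if part: "\<forall>j\<in>{1..k}. labeled_partial_partition n L (A j) (D j)"
      and B: "B \<subseteq> box_labels k A" "B \<noteq> {}" for A D B
    proof -
      \<comment> \<open>The representative in \<open>F\<close> of an arbitrary choice: it agrees
        with \<open>D\<close> at all labels of \<open>B\<close>, hence has the same rates and
        entropy.\<close>
      define D' where "D' = restrict (case_prod D) (J B)"
      have eq: "curry D' j (b j) = D j (b j)" if "j \<in> {1..k}" "b \<in> B" for j b
        using that by (auto simp: D'_def J_def)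
      have mem: "b j \<in> A j" if "j \<in> {1..k}" "b \<in> B" for j b
        using B(1) that by (auto simp: box_labels_def PiE_iff subset_iff)
      have "B \<subseteq> X"
      proof
        fix b assume "b \<in> B"
        moreover have "A j \<subseteq> {0..<L}" if "j \<in> {1..k}" for j
          using part that by (auto simp: labeled_partial_partition_def)
        ultimately show "b \<in> X"
          using B(1) PiE_mono[of "{1..k}" A "\<lambda>_. {0..<L}"] unfolding X_def box_labels_def by blast
      qed
      moreover have "D' \<in> E B"
        unfolding E_def D'_def restrict_PiE_iff
      proof
        fix x assume "x \<in> J B"
        then obtain j b where jb: "x = (j, b j)" "j \<in> {1..k}" "b \<in> B"
          by (auto simp: J_def)
        then show "case_prod D x \<in> Pow {1..n} - {{}}"
          using part mem[OF jb(2,3)] by (simp add: labeled_partial_partition_def)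
      qed
      moreover have "labeled_partial_partition n L ((\<lambda>b. b j) ` B) (curry D' j)"
        if j: "j \<in> {1..k}" for j
        using part[rule_format, OF j] mem[OF j] eq[OF j]
        by (auto simp: labeled_partial_partition_def disjoint_family_on_def)
      ultimately have "(B, D') \<in> F" using B by (auto simp: F_def V_def)
      then have "good \<omega> (curry D') B" using \<omega> by (auto simp: bad_def)
      moreover have "entropy_sum k n (curry D') B = entropy_sum k n D B"
        by (intro entropy_sum_cong eq)
      moreover have "(\<Sum>b\<in>B. label_rate k p (\<lambda>i. t i \<omega>) (curry D') b)
          = (\<Sum>b\<in>B. label_rate k p (\<lambda>i. t i \<omega>) D b)"
        by (intro sum.cong label_rate_cong eq refl)
      ultimately show ?thesis by (simp add: good_def)
    qed
    then show "\<omega> \<in> ?G" using \<omega> by blast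
  qed
  moreover have bad_sets: "bad ` F \<subseteq> sets M" using bad_meas by auto
  ultimately have "prob ?G = 1 - prob (\<Union>x\<in>F. bad x)"
    using finF by (subst prob_compl[symmetric]) auto
  moreover have "prob (\<Union>x\<in>F. bad x) \<le> real n powr (- R)"
  proof -
    define x where "x = 6 * exp (- c * ln (exp 1 * real L))"
    have "0 \<le> x" by (simp add: x_def)
    have "prob (\<Union>x\<in>F. bad x) \<le> (\<Sum>(B, D)\<in>F. prob (bad (B, D)))"
      using finite_measure_subadditive_finite[OF finF bad_sets] by (simp add: case_prod_unfold)
    also have "\<dots> \<le> (\<Sum>(B, D)\<in>F. x ^ card B * exp (- c * entropy_sum k n (curry D) B))"
      using bad_prob by (intro sum_mono) (auto simp: x_def)
    also have "\<dots> = (\<Sum>B\<in>Pow X - {{}}. x ^ card B * (\<Sum>D\<in>V B. exp (- c * entropy_sum k n (curry D) B)))"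
      unfolding F_def sum_distrib_left using X finE by (intro sum.Sigma[symmetric]) (auto simp: V_def)
    also have "\<dots> \<le> (\<Sum>B\<in>Pow X - {{}}. x ^ card B * real n powr (- R))"
    proof (intro sum_mono mult_left_mono)
      fix B assume B: "B \<in> Pow X - {{}}"
      \<comment> \<open>Passing to the larger set \<open>E B\<close> lets the classes vary
        independently, which is what makes the sum a product.\<close>
      have "(\<Sum>D\<in>V B. exp (- c * entropy_sum k n (curry D) B))
          \<le> (\<Sum>D\<in>E B. exp (- c * entropy_sum k n (curry D) B))"
        using finE B by (intro sum_mono2) (auto simp: V_def)
      also have "\<dots> \<le> real n powr (- R)"
        unfolding E_def J_def using assms finB B
        by (intro sum_exp_neg_entropy_sum_le) (auto simp: c_def)
      finally show "(\<Sum>D\<in>V B. exp (- c * entropy_sum k n (curry D) B)) \<le> \<dots>" .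
    qed (use \<open>0 \<le> x\<close> in auto)
    also have "\<dots> = (\<Sum>B\<in>Pow X - {{}}. x ^ card B) * real n powr (- R)"
      by (simp add: sum_distrib_right)
    \<comment> \<open>The classes have supplied the factor \<open>real n powr (- R)\<close>; the sum
      over collections contributes only 1.\<close>
    also have "\<dots> \<le> 1 * real n powr (- R)"
      unfolding x_def using assms X
      by (intro mult_right_mono sum_label_weight_le) (auto simp: c_def)
    finally show ?thesis by simp
  qed
  ultimately show ?thesis by (simp add: good_def)
qed

end
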